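(* Let $X$ be a finite set with $|X|=n$, and let $a\in\mathcal T_X$ be an idempotent with $r=\operatorname{rank}(a)<n$. Let $M=\{f\in\mathcal T_X:\operatorname{rank}(f)>r\}$. Then $\mathcal T_X^a=\langle M\rangle_a$. Further, any generating set for $\mathcal T_X^a$ contains $M$. Consequently, $M$ is the unique minimal (with respect to containment or size) generating set of $\mathcal T_X^a$, and $$\operatorname{rank}(\mathcal T_X^a)=|M|=\sum_{m=r+1}^n S(n,m)\binom nm m!,$$ where $S(n,m)$ denotes the (unsigned) Stirling number of the second kind.
   Context: $\mathcal T_X$ is the full transformation semigroup of all maps $X\to X$ under composition; maps are written on the right and composed from left to right. For $f\in\mathcal T_X$, $\operatorname{rank}(f)=|\operatorname{im}(f)|$. The variant $\mathcal T_X^a$ is the semigroup with underlying set $\mathcal T_X$ and operation $f\star g=fag$. For $U\subseteq\mathcal T_X$, $\langle U\rangle_a$ is the subsemigroup of $\mathcal T_X^a$ generated by $U$, i.e. the set of all products $u_1\star\cdots\star u_k$ with $k\ge1$ and $u_i\in U$. For a semigroup $S$, $\operatorname{rank}(S)$ is the least cardinality of a subset generating $S$ (as a semigroup). *)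

theory Defs
  imports Main "HOL-Library.Cardinality" "HOL-Combinatorics.Stirling"
begin

text \<open>
  The full transformation semigroup on \<open>X\<close> is the type \<open>'x \<Rightarrow> 'x\<close>, where the type \<open>'x\<close> (of class
  \<open>finite\<close>) plays the role of \<open>X\<close>. Maps act on the right and are composed from left to right, so
  \<open>f g\<close> means "first \<open>f\<close>, then \<open>g\<close>", i.e. \<open>g \<circ> f\<close> in terms of the library's composition.
\<close>

definition trans_mult :: "('x \<Rightarrow> 'x) \<Rightarrow> ('x \<Rightarrow> 'x) \<Rightarrow> ('x \<Rightarrow> 'x)"  (infixl \<open>\<cdot>\<close> 70)
  where "f \<cdot> g = g \<circ> f"

definition map_rank :: "('x \<Rightarrow> 'x) \<Rightarrow> nat"
  where "map_rank f = card (range f)"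

definition variant_mult :: "('x \<Rightarrow> 'x) \<Rightarrow> ('x \<Rightarrow> 'x) \<Rightarrow> ('x \<Rightarrow> 'x) \<Rightarrow> ('x \<Rightarrow> 'x)"
  where "variant_mult a f g = f \<cdot> a \<cdot> g"

lemma semigroup_variant_mult: "semigroup (variant_mult a)"
  by standard (simp add: variant_mult_def trans_mult_def comp_assoc)

inductive_set subsemigroup_generated :: "('s \<Rightarrow> 's \<Rightarrow> 's) \<Rightarrow> 's set \<Rightarrow> 's set"
  for mult :: "'s \<Rightarrow> 's \<Rightarrow> 's" and U :: "'s set"
  where
    base: "u \<in> U \<Longrightarrow> u \<in> subsemigroup_generated mult U"
  | mult: "\<lbrakk>u \<in> subsemigroup_generated mult U; v \<in> subsemigroup_generated mult U\<rbrakk>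
      \<Longrightarrow> mult u v \<in> subsemigroup_generated mult U"

lemma subsemigroup_generated_eq_products:
  assumes "semigroup mult"
  shows "subsemigroup_generated mult U = {foldl mult u us | u us. u \<in> U \<and> set us \<subseteq> U}"
    (is "_ = ?P")
proof -
  interpret semigroup mult by fact
  have assoc_foldl: "mult x (foldl mult u us) = foldl mult (mult x u) us" for x u us
    by (induction us arbitrary: u) (simp_all add: assoc)
  have "x \<in> ?P" if "x \<in> subsemigroup_generated mult U" for x
    using that
  proof induction
    case (base u)
    then show ?case by (intro CollectI exI[of _ u] exI[of _ "[]"]) simp
  next
    case (mult x y)
    then obtain u us v vs where x: "x = foldl mult u us" "u \<in> U" "set us \<subseteq> U"
      and y: "y = foldl mult v vs" "v \<in> U" "set vs \<subseteq> U" by blast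
    have "mult x y = foldl mult u (us @ v # vs)"
      unfolding x y by (simp add: assoc_foldl)
    with x y show ?case by (intro CollectI exI[of _ u] exI[of _ "us @ v # vs"]) simp
  qed
  moreover have "foldl mult u us \<in> subsemigroup_generated mult U"
    if "u \<in> subsemigroup_generated mult U" "set us \<subseteq> U" for u us
    using that
    by (induction us arbitrary: u) (auto intro: subsemigroup_generated.intros)
  ultimately show ?thesis
    by (blast intro: subsemigroup_generated.base)
qed

definition generates :: "('s \<Rightarrow> 's \<Rightarrow> 's) \<Rightarrow> 's set \<Rightarrow> 's set \<Rightarrow> bool"
  where "generates mult S U \<longleftrightarrow> U \<subseteq> S \<and> subsemigroup_generated mult U = S"

text \<open>
  The rank of a finitely generated semigroup with carrier \<open>S\<close>. Finiteness of \<open>U\<close> is required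
  because \<open>card\<close> is \<open>0\<close> on infinite sets; without a finite generating set the value is unspecified.
\<close>

definition semigroup_rank :: "('s \<Rightarrow> 's \<Rightarrow> 's) \<Rightarrow> 's set \<Rightarrow> nat"
  where "semigroup_rank mult S = (LEAST k. \<exists>U. generates mult S U \<and> finite U \<and> card U = k)"

definition minimal_generating_set :: "('s \<Rightarrow> 's \<Rightarrow> 's) \<Rightarrow> 's set \<Rightarrow> 's set \<Rightarrow> bool"
  where "minimal_generating_set mult S U \<longleftrightarrow>
    generates mult S U \<and> (\<forall>V. generates mult S V \<and> V \<subseteq> U \<longrightarrow> V = U)"

definition minimum_size_generating_set :: "('s \<Rightarrow> 's \<Rightarrow> 's) \<Rightarrow> 's set \<Rightarrow> 's set \<Rightarrow> bool"
  where "minimum_size_generating_set mult S U \<longleftrightarrow>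
    generates mult S U \<and> finite U \<and> (\<forall>V. generates mult S V \<and> finite V \<longrightarrow> card U \<le> card V)"

end

theory Submission
  imports Defs "HOL-Library.FuncSet"
begin

text \<open>
  Write \<open>f \<star> g\<close> for \<open>variant_mult a f g\<close>, that is \<open>g \<circ> a \<circ> f\<close>. Every such product factors
  through \<open>a\<close>, so it has rank at most the rank \<open>r\<close> of \<open>a\<close>; hence an element
  of rank above \<open>r\<close> is never a product and lies in every generating set
  (\<open>map_rank_variant_mult_le\<close>). Conversely, a map \<open>f\<close> of rank \<open>m \<le> r\<close> is a product \<open>g \<star> h\<close> of two
  maps of rank \<open>m + 1\<close> (\<open>variant_mult_rank_Suc_factors\<close>), so induction on
  \<open>CARD('x) - m\<close> puts every map in the semigroup generated by \<open>M\<close>.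

  For the factorization, fix \<open>x \<noteq> y\<close> with \<open>f x = f y\<close>, a point \<open>z\<close> outside the range of \<open>a\<close>, and an
  injection \<open>\<phi>\<close> from the range of \<open>f\<close> into that of \<open>a\<close> with \<open>\<phi> (f x) = a z\<close>. Let \<open>g\<close> be \<open>\<phi> \<circ> f\<close>,
  except that \<open>g x = z\<close>. As \<open>a\<close> fixes its range, \<open>a \<circ> g = \<phi> \<circ> f\<close>, and \<open>h\<close> need only invert \<open>\<phi>\<close>.
  The point \<open>z\<close> adds one to the rank of \<open>g\<close>, since \<open>y\<close> still attains the value \<open>a z\<close>; and \<open>h\<close> is free
  at \<open>z\<close>, where it can take a value outside the range of \<open>f\<close>.

  The formula for \<open>|M|\<close> sorts the maps by their range: a set of size \<open>m\<close> is the range of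
  \<open>Stirling n m * fact m\<close> maps (\<open>card_extensional_surjections\<close>).
\<close>

section \<open>Generation\<close>

lemma map_rank_variant_mult_le:
  fixes a :: "'x::finite \<Rightarrow> 'x"
  shows "map_rank (variant_mult a f g) \<le> map_rank a"
proof -
  have "range (variant_mult a f g) \<subseteq> g ` range a"
    by (auto simp: variant_mult_def trans_mult_def)
  then have "card (range (variant_mult a f g)) \<le> card (g ` range a)"
    by (intro card_mono) auto
  also have "\<dots> \<le> card (range a)"
    by (intro card_image_le) auto
  finally show ?thesis
    by (simp add: map_rank_def)
qed

lemma obtain_inj_on_prescribed_value:
  assumes "finite A" "finite B" "card A \<le> card B" "p \<in> A" "q \<in> B"
  obtains \<phi> where "inj_on \<phi> A" "\<phi> ` A \<subseteq> B" "\<phi> p = q"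
proof -
  have "card (A - {p}) \<le> card (B - {q})"
    using assms by simp
  then obtain \<psi> where \<psi>: "\<psi> ` (A - {p}) \<subseteq> B - {q}" "inj_on \<psi> (A - {p})"
    using card_le_inj[of "A - {p}" "B - {q}"] assms by auto
  show ?thesis
  proof
    show "inj_on (\<psi>(p := q)) A"
      using \<psi> by (auto simp: inj_on_def)
    show "(\<psi>(p := q)) ` A \<subseteq> B"
      using \<psi> assms by auto
  qed simp
qed

lemma variant_mult_rank_Suc_factors:
  fixes a :: "'x::finite \<Rightarrow> 'x"
  assumes idem: "a \<cdot> a = a" and small: "map_rank a < CARD('x)"
    and le: "map_rank f \<le> map_rank a"
  obtains g h where "f = variant_mult a g h"
    and "map_rank g = Suc (map_rank f)" and "map_rank h = Suc (map_rank f)"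
proof -
  have a_fix: "a v = v" if "v \<in> range a" for v
    using idem that by (auto simp: trans_mult_def fun_eq_iff)
  have "range a \<noteq> UNIV" "range f \<noteq> UNIV"
    using small le by (auto simp: map_rank_def)
  then obtain z q where z: "z \<notin> range a" and q: "q \<notin> range f"
    by blast
  then have "\<not> inj f"
    using finite_UNIV_inj_surj[of f] by auto
  then obtain x y where xy: "x \<noteq> y" "f x = f y"
    by (auto simp: inj_def)
  obtain \<phi> where \<phi>: "inj_on \<phi> (range f)" "\<phi> ` range f \<subseteq> range a" "\<phi> (f x) = a z"
    using obtain_inj_on_prescribed_value[of "range f" "range a" "f x" "a z"] le
    by (auto simp: map_rank_def)
  define g where "g = (\<phi> \<circ> f)(x := z)"
  define h where "h v = (if v \<in> \<phi> ` range f then the_inv_into (range f) \<phi> v else q)" for v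
  have h_inv: "h (\<phi> (f u)) = f u" for u
    using \<phi>(1) by (simp add: h_def the_inv_into_f_f)
  have z_notin: "z \<notin> \<phi> ` range f"
    using z \<phi>(2) by auto
  show thesis
  proof
    have "a (g u) = \<phi> (f u)" for u
      using \<phi>(3) a_fix[of "\<phi> (f u)"] subsetD[OF \<phi>(2)] by (cases "u = x") (simp_all add: g_def)
    then show "f = variant_mult a g h"
      by (simp add: fun_eq_iff variant_mult_def trans_mult_def h_inv)
    have "range g = insert z (\<phi> ` range f)"
    proof
      show "range g \<subseteq> insert z (\<phi> ` range f)"
        by (auto simp: g_def)
      have "\<phi> (f u) \<in> range g" for u
      proof (cases "u = x")
        case True
        then have "\<phi> (f u) = g y"
          using xy by (simp add: g_def)
        then show ?thesis by simp
      next
        case False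
        then have "\<phi> (f u) = g u"
          by (simp add: g_def)
        then show ?thesis by simp
      qed
      moreover have "z = g x"
        by (simp add: g_def)
      ultimately show "insert z (\<phi> ` range f) \<subseteq> range g"
        by auto
    qed
    then show "map_rank g = Suc (map_rank f)"
      using z_notin card_image[OF \<phi>(1)] by (simp add: map_rank_def)
    have "range h = insert q (range f)"
    proof
      show "range h \<subseteq> insert q (range f)"
        by (auto simp: h_def h_inv[unfolded h_def] the_inv_into_f_f[OF \<phi>(1)])
      have "h z = q"
        using z_notin by (simp add: h_def)
      then have "q \<in> range h"
        by auto
      moreover have "f u \<in> range h" for u
        using h_inv[of u] by (metis rangeI)
      ultimately show "insert q (range f) \<subseteq> range h"
        by auto
    qed
    then show "map_rank h = Suc (map_rank f)"
      using q by (simp add: map_rank_def)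
  qed
qed

lemma large_rank_maps_generate:
  fixes a :: "'x::finite \<Rightarrow> 'x"
  assumes "a \<cdot> a = a" and "map_rank a < CARD('x)"
  shows "f \<in> subsemigroup_generated (variant_mult a) {f. map_rank f > map_rank a}"
proof (induction "CARD('x) - map_rank f" arbitrary: f rule: less_induct)
  case less
  show ?case
  proof (cases "map_rank f > map_rank a")
    case True
    then show ?thesis
      by (auto intro: subsemigroup_generated.base)
  next
    case False
    then obtain g h where gh: "f = variant_mult a g h"
      "map_rank g = Suc (map_rank f)" "map_rank h = Suc (map_rank f)"
      using variant_mult_rank_Suc_factors[OF assms] by (metis not_less)
    have "map_rank f < CARD('x)"
      using False assms(2) by simp
    then show ?thesis
      unfolding gh(1) using gh
      by (intro subsemigroup_generated.mult less) auto
  qed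
qed

lemma large_rank_maps_subset_generating_set:
  fixes a :: "'x::finite \<Rightarrow> 'x"
  assumes "generates (variant_mult a) UNIV U"
  shows "{f. map_rank f > map_rank a} \<subseteq> U"
proof
  fix f :: "'x \<Rightarrow> 'x"
  assume f: "f \<in> {f. map_rank f > map_rank a}"
  have "f \<in> subsemigroup_generated (variant_mult a) U"
    using assms by (simp add: generates_def)
  then show "f \<in> U"
  proof cases
    case (mult u v)
    then show ?thesis
      using f map_rank_variant_mult_le[of a u v] by auto
  qed
qed

section \<open>Minimal generating sets\<close>

lemma minimal_generating_set_iff_least:
  assumes "generates m S M" and "\<And>U. generates m S U \<Longrightarrow> M \<subseteq> U"
  shows "minimal_generating_set m S U \<longleftrightarrow> U = M"
  using assms unfolding minimal_generating_set_def by blast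

lemma minimum_size_generating_set_iff_least:
  assumes "generates m S M" and "\<And>U. generates m S U \<Longrightarrow> M \<subseteq> U" and "finite M"
  shows "minimum_size_generating_set m S U \<longleftrightarrow> U = M"
  using assms unfolding minimum_size_generating_set_def
  by (metis card_mono card_seteq)

lemma semigroup_rank_eq_card_least:
  assumes "generates m S M" and "\<And>U. generates m S U \<Longrightarrow> M \<subseteq> U" and "finite M"
  shows "semigroup_rank m S = card M"
  unfolding semigroup_rank_def
  using assms by (intro Least_equality) (auto intro: card_mono)

section \<open>Counting maps by rank\<close>

text \<open>
  Maps defined on \<open>A\<close> are represented by extensional functions, so that each is counted once. The
  induction removes a point \<open>x\<close> of the domain: a surjection onto \<open>B\<close> sending \<open>x\<close> to \<open>b\<close> restricts to
  a map with image \<open>B\<close> or \<open>B - {b}\<close>, which matches the recurrence of the Stirling numbers.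
\<close>
lemma card_extensional_surjections:
  assumes "finite A" "finite B"
  shows "card {f \<in> extensional A. f ` A = B} = Stirling (card A) (card B) * fact (card B)"
  using assms
proof (induction A arbitrary: B rule: finite_induct)
  case empty
  show ?case
  proof (cases "B = {}")
    case False
    then have "Stirling 0 (card B) = 0"
      using empty by (cases "card B") auto
    then show ?thesis
      using False by simp
  qed simp
next
  case (insert x A)
  let ?S = "\<lambda>C. {f \<in> extensional A. f ` A = C}"
  have fin: "finite (?S C)" if "finite C" for C :: "'b set"
    using insert.hyps that
    by (intro finite_subset[OF _ finite_PiE[of A "\<lambda>_. C"]]) (auto simp: PiE_def)
  have inj: "inj_on (\<lambda>(b, g). g(x := b)) (SIGMA b:B. ?S B \<union> ?S (B - {b}))"
  proof (rule inj_onI, clarify)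
    fix b g c h
    assume eq: "g(x := b) = h(x := c)"
      and g: "g \<in> ?S B \<union> ?S (B - {b})" and h: "h \<in> ?S B \<union> ?S (B - {c})"
    \<comment> \<open>Both functions take the default value \<open>undefined\<close> at \<open>x\<close>, which lies outside \<open>A\<close>.\<close>
    from g h have "g x = h x"
      using insert.hyps by (auto simp: extensional_def)
    with eq show "b = c \<and> g = h"
      by (metis fun_upd_same fun_upd_triv fun_upd_upd)
  qed
  have "{f \<in> extensional (insert x A). f ` insert x A = B}
      = (\<lambda>(b, g). g(x := b)) ` (SIGMA b:B. ?S B \<union> ?S (B - {b}))" (is "?L = ?R")
  proof
    show "?L \<subseteq> ?R"
    proof
      fix f
      assume f: "f \<in> ?L"
      let ?g = "f(x := undefined)"
      have "?g ` A = f ` A"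
        using insert.hyps by (intro image_cong) auto
      moreover have "?g \<in> extensional A"
        using f by (auto simp: extensional_def)
      moreover have "f ` A = B \<or> f ` A = B - {f x}" "f x \<in> B"
        using f by blast+
      moreover have "f = ?g(x := f x)"
        by simp
      ultimately show "f \<in> ?R"
        by (intro image_eqI[of _ _ "(f x, ?g)"]) auto
    qed
    show "?R \<subseteq> ?L"
    proof
      fix f
      assume "f \<in> ?R"
      then obtain b g where f: "f = g(x := b)" and "b \<in> B" and g: "g \<in> ?S B \<union> ?S (B - {b})"
        by auto
      have "f ` A = g ` A"
        unfolding f using insert.hyps by (intro image_cong) auto
      then have "f ` insert x A = B"
        using f \<open>b \<in> B\<close> g by (simp only: image_insert fun_upd_same) auto
      moreover have "f \<in> extensional (insert x A)"
        using f g by (auto simp: extensional_def)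
      ultimately show "f \<in> ?L"
        by simp
    qed
  qed
  then have "card {f \<in> extensional (insert x A). f ` insert x A = B}
      = (\<Sum>b\<in>B. card (?S B \<union> ?S (B - {b})))"
    using insert.prems fin by (simp only: card_image[OF inj], subst card_SigmaI) auto
  also have "\<dots> = (\<Sum>b\<in>B. card (?S B) + card (?S (B - {b})))"
    using insert.prems fin by (intro sum.cong refl card_Un_disjoint) auto
  also have "\<dots> = (\<Sum>b\<in>B. Stirling (card A) (card B) * fact (card B)
      + Stirling (card A) (card B - 1) * fact (card B - 1))"
    using insert.prems insert.IH by (intro sum.cong refl) simp
  also have "\<dots> = Stirling (card (insert x A)) (card B) * fact (card B)"
    using insert.hyps by (cases "card B") (auto simp: algebra_simps)
  finally show ?case .
qed

lemma card_maps_of_rank: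
  "card {f :: 'x::finite \<Rightarrow> 'x. map_rank f = m}
    = Stirling CARD('x) m * (CARD('x) choose m) * fact m"
proof -
  let ?P = "{B :: 'x set. card B = m}"
  have "{f :: 'x \<Rightarrow> 'x. map_rank f = m} = (\<Union>B\<in>?P. {f. range f = B})"
    by (auto simp: map_rank_def)
  then have "card {f :: 'x \<Rightarrow> 'x. map_rank f = m} = (\<Sum>B\<in>?P. card {f :: 'x \<Rightarrow> 'x. range f = B})"
    by (simp, subst card_UN_disjoint) auto
  also have "\<dots> = (\<Sum>B\<in>?P. Stirling CARD('x) m * fact m)"
    using card_extensional_surjections[of "UNIV :: 'x set" "_ :: 'x set"]
    by (intro sum.cong refl) (simp add: extensional_def)
  also have "\<dots> = Stirling CARD('x) m * (CARD('x) choose m) * fact m"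
    using n_subsets[of "UNIV :: 'x set" m] by simp
  finally show ?thesis .
qed

lemma card_maps_of_rank_greater:
  "card {f :: 'x::finite \<Rightarrow> 'x. map_rank f > r}
    = (\<Sum>m = r + 1..CARD('x). Stirling CARD('x) m * (CARD('x) choose m) * fact m)"
proof -
  have "map_rank f \<le> CARD('x)" for f :: "'x \<Rightarrow> 'x"
    by (simp add: map_rank_def card_mono)
  then have "{f :: 'x \<Rightarrow> 'x. map_rank f > r} = (\<Union>m\<in>{r + 1..CARD('x)}. {f. map_rank f = m})"
    by auto
  then have "card {f :: 'x \<Rightarrow> 'x. map_rank f > r}
      = (\<Sum>m = r + 1..CARD('x). card {f :: 'x \<Rightarrow> 'x. map_rank f = m})"
    by (simp, subst card_UN_disjoint) auto
  then show ?thesis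
    by (simp add: card_maps_of_rank)
qed

theorem theorem4p6:
  fixes a :: "'x::finite \<Rightarrow> 'x" and n r :: nat and M :: "('x \<Rightarrow> 'x) set"
  assumes "CARD('x) = n"
    and "a \<cdot> a = a"
    and "r = map_rank a" and "r < n"
    and "M = {f. map_rank f > r}"
  shows "subsemigroup_generated (variant_mult a) M = UNIV
    \<and> (\<forall>U. generates (variant_mult a) UNIV U \<longrightarrow> M \<subseteq> U)
    \<and> (\<forall>U. minimal_generating_set (variant_mult a) UNIV U \<longleftrightarrow> U = M)
    \<and> (\<forall>U. minimum_size_generating_set (variant_mult a) UNIV U \<longleftrightarrow> U = M)
    \<and> semigroup_rank (variant_mult a) UNIV = card M
    \<and> card M = (\<Sum>m = r + 1..n. Stirling n m * (n choose m) * fact m)"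
proof -
  have gen: "subsemigroup_generated (variant_mult a) M = UNIV"
    using large_rank_maps_generate[of a] assms by auto
  then have M: "generates (variant_mult a) UNIV M"
    by (simp add: generates_def)
  have least: "M \<subseteq> U" if "generates (variant_mult a) UNIV U" for U
    using large_rank_maps_subset_generating_set[OF that] assms by simp
  have "finite M"
    by simp
  have "card M = (\<Sum>m = r + 1..n. Stirling n m * (n choose m) * fact m)"
    using card_maps_of_rank_greater[where 'x = 'x, of r] assms by simp
  then show ?thesis
    using gen least minimal_generating_set_iff_least[OF M least]
      minimum_size_generating_set_iff_least[OF M least \<open>finite M\<close>]
      semigroup_rank_eq_card_least[OF M least \<open>finite M\<close>]
    by auto
qed

end
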